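(* (1) Let $X$ be a Banach space and $T\in L(X)$. The following statements are equivalent: (i) $T$ has a Moore-Penrose inverse; (ii) there exist $P$ and $Q$ in $\mathcal{E}(X)$ such that $N(P)=N(T)$ and $R(Q)=R(T)$. (2) Let $A$ be a unital Banach algebra and $a\in A$. The following statements are equivalent: (i) the map $L_a$ has a Moore-Penrose inverse in $L(A)$; (ii) there exist $P$ and $Q$ in $\mathcal{E}(A)$ such that $N(P)=a^{-1}(0)$ and $R(Q)=aA$. Likewise, the following statements are equivalent: (i') the map $R_a$ has a Moore-Penrose inverse in $L(A)$; (ii') there exist $P$ and $Q$ in $\mathcal{E}(A)$ such that $N(P)=a_{-1}(0)$ and $R(Q)=Aa$. Furthermore, in each case, if such $P$ and $Q$ exist, then they are unique.
   Context: Scalars are complex. A unital Banach algebra $A$ has a unit $e$ with $\|e\|=1$. For a Banach space $X$, $L(X)$ is the Banach algebra of bounded linear operators on $X$ with the operator norm; $N(T)$ and $R(T)$ are the null space and range of $T\in L(X)$. $L(A)$ denotes the bounded linear operators on the Banach space $A$. For $a\in A$, $L_a,R_a\in L(A)$ are $L_a(x)=ax$, $R_a(x)=xa$; $a^{-1}(0)=N(L_a)=\{x\in A: ax=0\}$, $a_{-1}(0)=N(R_a)=\{x\in A: xa=0\}$, $aA=R(L_a)$, $Aa=R(R_a)$. An element $h$ of a unital Banach algebra is hermitian if $\|\exp(ith)\|=1$ for all $t\in\mathbb{R}$. $\mathcal{E}(X)=\{P\in L(X): P^2=P,\ P\text{ is hermitian in }L(X)\}$, and $\mathcal{E}(A)$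 is this set for the Banach space $A$ (so $\mathcal{E}(A)\subseteq L(A)$). The Moore-Penrose inverse of $T\in L(X)$, denoted $T^{\dagger}$, is the (at most one) $S\in L(X)$ with $T=TST$, $S=STS$, and $TS$ and $ST$ hermitian. *)

theory Defs
  imports "HOL-Analysis.Analysis"
begin

section \<open>Complex Banach spaces and algebras\<close>

class complex_normed_vector = real_normed_vector +
  fixes scaleC :: "complex \<Rightarrow> 'a \<Rightarrow> 'a"  (infixr \<open>*\<^sub>C\<close> 75)
  assumes scaleC_add_right: "c *\<^sub>C (x + y) = c *\<^sub>C x + c *\<^sub>C y"
    and scaleC_add_left: "(c + d) *\<^sub>C x = c *\<^sub>C x + d *\<^sub>C x"
    and scaleC_scaleC: "c *\<^sub>C (d *\<^sub>C x) = (c * d) *\<^sub>C x"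
    and scaleC_of_real: "complex_of_real r *\<^sub>C x = r *\<^sub>R x"
    and norm_scaleC: "norm (c *\<^sub>C x) = cmod c * norm x"

class complex_banach = complex_normed_vector + complete_space
begin
subclass banach ..
end

class complex_banach_algebra = complex_banach + real_normed_algebra +
  assumes mult_scaleC_left: "(c *\<^sub>C x) * y = c *\<^sub>C (x * y)"
    and mult_scaleC_right: "x * (c *\<^sub>C y) = c *\<^sub>C (x * y)"

text \<open>The class \<^class>\<open>real_normed_algebra_1\<close> contributes the unit and the axiom
  \<^prop>\<open>norm 1 = (1::real)\<close>.\<close>

class complex_unital_banach_algebra = complex_banach_algebra + real_normed_algebra_1

instantiation complex :: complex_unital_banach_algebra
begin

definition scaleC_complex :: "complex \<Rightarrow> complex \<Rightarrow> complex"
  where "scaleC_complex c x = c * x"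

instance
  by standard (simp_all add: scaleC_complex_def algebra_simps norm_mult scaleR_conv_of_real)

end

lemma bounded_linear_scaleC:
  "bounded_linear (\<lambda>x::'a::complex_normed_vector. c *\<^sub>C x)"
proof (rule bounded_linear_intro[where K = "cmod c"])
  fix r and x :: 'a
  show "c *\<^sub>C (r *\<^sub>R x) = r *\<^sub>R (c *\<^sub>C x)"
    by (simp add: scaleC_of_real[symmetric] scaleC_scaleC mult.commute)
qed (simp_all add: scaleC_add_right norm_scaleC mult.commute)


section \<open>The Banach algebra of bounded operators on a complex space\<close>

typedef (overloaded) 'a bdd_op =
  "{T :: 'a::complex_normed_vector \<Rightarrow>\<^sub>L 'a. \<forall>c x. T (c *\<^sub>C x) = c *\<^sub>C T x}"
  morphisms blinfun_of Bdd_op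
  by (rule exI[of _ 0]) (simp add: norm_eq_zero[symmetric] norm_scaleC del: norm_eq_zero)

setup_lifting type_definition_bdd_op

lift_definition apply_op :: "'a::complex_normed_vector bdd_op \<Rightarrow> 'a \<Rightarrow> 'a" is blinfun_apply .

lemma scaleC_zero_right [simp]: "c *\<^sub>C (0::'a::complex_normed_vector) = 0"
  using linear_0[OF bounded_linear.linear[OF bounded_linear_scaleC]] .

lemma scaleC_minus_right: "c *\<^sub>C (- x) = - (c *\<^sub>C (x::'a::complex_normed_vector))"
  by (rule linear_neg[OF bounded_linear.linear[OF bounded_linear_scaleC]])

lemma scaleC_diff_right: "c *\<^sub>C (x - y) = c *\<^sub>C x - c *\<^sub>C (y::'a::complex_normed_vector)"
  by (rule linear_diff[OF bounded_linear.linear[OF bounded_linear_scaleC]])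

lemma scaleC_scaleR: "c *\<^sub>C (r *\<^sub>R x) = r *\<^sub>R (c *\<^sub>C (x::'a::complex_normed_vector))"
  by (rule linear_scale[OF bounded_linear.linear[OF bounded_linear_scaleC]])

instantiation bdd_op :: (complex_normed_vector) real_normed_vector
begin

lift_definition zero_bdd_op :: "'a bdd_op" is 0 by simp
lift_definition plus_bdd_op :: "'a bdd_op \<Rightarrow> 'a bdd_op \<Rightarrow> 'a bdd_op" is "(+)"
  by (simp add: blinfun.add_left scaleC_add_right)
lift_definition minus_bdd_op :: "'a bdd_op \<Rightarrow> 'a bdd_op \<Rightarrow> 'a bdd_op" is "(-)"
  by (simp add: blinfun.diff_left scaleC_diff_right)
lift_definition uminus_bdd_op :: "'a bdd_op \<Rightarrow> 'a bdd_op" is uminus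
  by (simp add: blinfun.minus_left scaleC_minus_right)
lift_definition scaleR_bdd_op :: "real \<Rightarrow> 'a bdd_op \<Rightarrow> 'a bdd_op" is scaleR
  by (simp add: blinfun.scaleR_left scaleC_scaleR)
lift_definition norm_bdd_op :: "'a bdd_op \<Rightarrow> real" is norm .
definition dist_bdd_op :: "'a bdd_op \<Rightarrow> 'a bdd_op \<Rightarrow> real"
  where "dist_bdd_op S T = norm (S - T)"
definition sgn_bdd_op :: "'a bdd_op \<Rightarrow> 'a bdd_op"
  where "sgn_bdd_op T = inverse (norm T) *\<^sub>R T"
definition uniformity_bdd_op :: "('a bdd_op \<times> 'a bdd_op) filter"
  where "uniformity_bdd_op = (INF e\<in>{0<..}. principal {(S, T). dist S T < e})"
definition open_bdd_op :: "'a bdd_op set \<Rightarrow> bool"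
  where "open_bdd_op U \<longleftrightarrow> (\<forall>S\<in>U. \<forall>\<^sub>F (S', T) in uniformity. S' = S \<longrightarrow> T \<in> U)"

instance
proof
  fix r s :: real and S T U :: "'a bdd_op"
  show "S + T + U = S + (T + U)" "S + T = T + S" "0 + T = T" "- T + T = 0" "S - T = S + - T"
    by (transfer, simp add: algebra_simps)+
  show "r *\<^sub>R (S + T) = r *\<^sub>R S + r *\<^sub>R T" "(r + s) *\<^sub>R T = r *\<^sub>R T + s *\<^sub>R T"
    "r *\<^sub>R s *\<^sub>R T = (r * s) *\<^sub>R T" "1 *\<^sub>R T = T"
    by (transfer, simp add: algebra_simps)+
  show "norm T = 0 \<longleftrightarrow> T = 0" "norm (r *\<^sub>R T) = \<bar>r\<bar> * norm T" "norm (S + T) \<le> norm S + norm T"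
    by (transfer, simp add: norm_triangle_ineq)+
qed (simp_all only: dist_bdd_op_def sgn_bdd_op_def uniformity_bdd_op_def open_bdd_op_def)

end

instantiation bdd_op :: (complex_normed_vector) complex_normed_vector
begin

lift_definition scaleC_bdd_op :: "complex \<Rightarrow> 'a bdd_op \<Rightarrow> 'a bdd_op"
  is "\<lambda>c T. blinfun_compose (Blinfun (\<lambda>x. c *\<^sub>C x)) T"
  by (simp add: bounded_linear_Blinfun_apply[OF bounded_linear_scaleC] scaleC_scaleC mult.commute)

instance
proof
  fix c d :: complex and r :: real and S T :: "'a bdd_op"
  note B = bounded_linear_Blinfun_apply[OF bounded_linear_scaleC]
  show "c *\<^sub>C (S + T) = c *\<^sub>C S + c *\<^sub>C T"
    by transfer (rule blinfun_eqI, simp add: B blinfun.add_left scaleC_add_right)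
  show "(c + d) *\<^sub>C T = c *\<^sub>C T + d *\<^sub>C T"
    by transfer (rule blinfun_eqI, simp add: B blinfun.add_left scaleC_add_left)
  show "c *\<^sub>C d *\<^sub>C T = (c * d) *\<^sub>C T"
    by transfer (rule blinfun_eqI, simp add: B scaleC_scaleC)
  show "complex_of_real r *\<^sub>C T = r *\<^sub>R T"
    by transfer (rule blinfun_eqI, simp add: B scaleC_of_real blinfun.scaleR_left)
  show "norm (c *\<^sub>C T) = cmod c * norm T"
  proof transfer
    fix c :: complex and T :: "'a \<Rightarrow>\<^sub>L 'a"
    have "norm (Blinfun ((*\<^sub>C) c) o\<^sub>L T) = onorm (\<lambda>x. c *\<^sub>C T x)"
      by (simp add: norm_blinfun.rep_eq B fun_eq_iff arg_cong[where f = onorm])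
    also have "\<dots> = onorm (\<lambda>x. cmod c *\<^sub>R T x)"
      by (simp add: onorm_def norm_scaleC)
    also have "\<dots> = cmod c * norm T"
      by (simp add: onorm_scaleR[OF blinfun.bounded_linear_right] norm_blinfun.rep_eq)
    finally show "norm (Blinfun ((*\<^sub>C) c) o\<^sub>L T) = cmod c * norm T" .
  qed
qed

end

instance bdd_op :: (complex_banach) complex_banach
proof
  fix X :: "nat \<Rightarrow> 'a bdd_op"
  assume "Cauchy X"
  then have "Cauchy (\<lambda>n. blinfun_of (X n))"
    by (simp add: Cauchy_def dist_norm norm_bdd_op.rep_eq minus_bdd_op.rep_eq)
  then obtain L where L: "(\<lambda>n. blinfun_of (X n)) \<longlonglongrightarrow> L"
    using Cauchy_convergent convergent_def by blast
  have "L (c *\<^sub>C x) = c *\<^sub>C L x" for c x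
  proof (rule LIMSEQ_unique)
    have lim: "(\<lambda>n. blinfun_of (X n) y) \<longlonglongrightarrow> L y" for y
      using L by (intro tendsto_intros)
    show "(\<lambda>n. blinfun_of (X n) (c *\<^sub>C x)) \<longlonglongrightarrow> L (c *\<^sub>C x)"
      by (rule lim)
    have "blinfun_of (X n) (c *\<^sub>C x) = c *\<^sub>C blinfun_of (X n) x" for n
      using blinfun_of[of "X n"] by simp
    moreover have "(\<lambda>n. c *\<^sub>C blinfun_of (X n) x) \<longlonglongrightarrow> c *\<^sub>C L x"
      by (rule bounded_linear.tendsto[OF bounded_linear_scaleC lim])
    ultimately show "(\<lambda>n. blinfun_of (X n) (c *\<^sub>C x)) \<longlonglongrightarrow> c *\<^sub>C L x"
      using blinfun_of by simp
  qed
  then have "blinfun_of (Bdd_op L) = L"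
    by (simp add: Bdd_op_inverse)
  with L have "X \<longlonglongrightarrow> Bdd_op L"
    by (simp add: LIMSEQ_def dist_norm norm_bdd_op.rep_eq minus_bdd_op.rep_eq)
  then show "convergent X"
    by (rule convergentI)
qed

instantiation bdd_op :: (complex_normed_vector) "{real_normed_algebra, monoid_mult}"
begin

lift_definition times_bdd_op :: "'a bdd_op \<Rightarrow> 'a bdd_op \<Rightarrow> 'a bdd_op" is blinfun_compose
  by simp
lift_definition one_bdd_op :: "'a bdd_op" is id_blinfun
  by simp

instance
proof
  fix r :: real and S T U :: "'a bdd_op"
  show "S * T * U = S * (T * U)"
    by transfer (rule blinfun_eqI, simp)
  show "(S + T) * U = S * U + T * U" "S * (T + U) = S * T + S * U"
    by (transfer, rule blinfun_eqI, simp add: blinfun.add_left blinfun.add_right)+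
  show "r *\<^sub>R S * T = r *\<^sub>R (S * T)" "S * r *\<^sub>R T = r *\<^sub>R (S * T)"
    by (transfer, rule blinfun_eqI, simp add: blinfun.scaleR_left blinfun.scaleR_right)+
  show "norm (S * T) \<le> norm S * norm T"
    by transfer (rule norm_blinfun_compose)
  show "1 * T = T" "T * 1 = T"
    by (transfer, rule blinfun_eqI, simp)+
qed

end

instance bdd_op :: (complex_banach) complex_banach_algebra
proof
  fix c and S T :: "'a bdd_op"
  note B = bounded_linear_Blinfun_apply[OF bounded_linear_scaleC]
  show "c *\<^sub>C S * T = c *\<^sub>C (S * T)" "S * c *\<^sub>C T = c *\<^sub>C (S * T)"
    by (transfer, rule blinfun_eqI, simp add: B)+
qed

lemma apply_op_simps [simp]:
  "apply_op 0 x = 0"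
  "apply_op 1 x = x"
  "apply_op (S + T) x = apply_op S x + apply_op T x"
  "apply_op (S - T) x = apply_op S x - apply_op T x"
  "apply_op (- T) x = - apply_op T x"
  "apply_op (c *\<^sub>C T) x = c *\<^sub>C apply_op T x"
  "apply_op (S * T) x = apply_op S (apply_op T x)"
  by (transfer, simp add: blinfun.add_left blinfun.diff_left blinfun.minus_left
      bounded_linear_Blinfun_apply[OF bounded_linear_scaleC])+

lemma apply_op_linear:
  "apply_op T (x + y) = apply_op T x + apply_op T y"
  "apply_op T (c *\<^sub>C x) = c *\<^sub>C apply_op T x"
  by (transfer, simp add: blinfun.add_right)+

lemma bdd_op_eqI: "(\<And>x. apply_op S x = apply_op T x) \<Longrightarrow> S = T"
  by transfer (rule blinfun_eqI)

lemma norm_bdd_op_onorm: "norm T = onorm (apply_op T)"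
  by transfer (rule norm_blinfun.rep_eq)

definition null_space :: "'a::complex_normed_vector bdd_op \<Rightarrow> 'a set"
  where "null_space T = {x. apply_op T x = 0}"

definition range_space :: "'a::complex_normed_vector bdd_op \<Rightarrow> 'a set"
  where "range_space T = range (apply_op T)"


section \<open>Hermitian elements and Moore-Penrose inverses\<close>

text \<open>The library function \<^const>\<open>exp\<close> requires \<^class>\<open>real_normed_algebra_1\<close>, hence
  \<^prop>\<open>norm 1 = (1::real)\<close>, which fails for the operators on the zero space. The same series is
  therefore taken here over the weaker sort; the two agree whenever both are available.\<close>

definition banach_exp :: "'a::{complex_banach_algebra, monoid_mult} \<Rightarrow> 'a"
  where "banach_exp a = (\<Sum>n. a ^ n /\<^sub>R fact n)"

lemma banach_exp_eq_exp: "banach_exp a = exp (a::'a::complex_unital_banach_algebra)"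
  by (simp add: banach_exp_def exp_def)

definition hermitian :: "'a::{complex_banach_algebra, monoid_mult} \<Rightarrow> bool"
  where "hermitian h \<longleftrightarrow> (\<forall>t::real. norm (banach_exp ((\<i> * complex_of_real t) *\<^sub>C h)) = 1)"

definition hermitian_idempotents :: "'a::complex_banach bdd_op set"  (\<open>\<E>\<close>)
  where "\<E> = {P. P * P = P \<and> hermitian P}"

definition moore_penrose_inverse :: "'a::complex_banach bdd_op \<Rightarrow> 'a bdd_op \<Rightarrow> bool"
  where "moore_penrose_inverse T S \<longleftrightarrow>
    T = T * S * T \<and> S = S * T * S \<and> hermitian (T * S) \<and> hermitian (S * T)"

definition has_moore_penrose_inverse :: "'a::complex_banach bdd_op \<Rightarrow> bool"
  where "has_moore_penrose_inverse T \<longleftrightarrow> (\<exists>S. moore_penrose_inverse T S)"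


section \<open>Multiplication operators on a Banach algebra\<close>

lift_definition left_mult_op :: "'a::complex_banach_algebra \<Rightarrow> 'a bdd_op"
  is "\<lambda>a. Blinfun (\<lambda>x. a * x)"
  by (simp add: bounded_linear_Blinfun_apply[OF bounded_linear_mult_right] mult_scaleC_right)

lift_definition right_mult_op :: "'a::complex_banach_algebra \<Rightarrow> 'a bdd_op"
  is "\<lambda>a. Blinfun (\<lambda>x. x * a)"
  by (simp add: bounded_linear_Blinfun_apply[OF bounded_linear_mult_left] mult_scaleC_left)

lemma apply_left_mult_op [simp]: "apply_op (left_mult_op a) x = a * x"
  by transfer (simp add: bounded_linear_Blinfun_apply[OF bounded_linear_mult_right])

lemma apply_right_mult_op [simp]: "apply_op (right_mult_op a) x = x * a"
  by transfer (simp add: bounded_linear_Blinfun_apply[OF bounded_linear_mult_left])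

end

theory Submission
  imports Defs
begin

text \<open>The uniqueness statements need only one value of the exponential: for an idempotent
  hermitian \<open>P\<close>, taking \<open>t = \<pi>\<close> gives \<open>\<parallel>1 - 2P\<parallel> = 1\<close>. If \<open>P\<close> and \<open>Q\<close> have the same range or the
  same null space, then \<open>(1 - 2P)(1 - 2Q) = 1 + D\<close> with \<open>D = \<plusminus>2(P - Q)\<close> and \<open>D\<^sup>2 = 0\<close>, so
  \<open>\<parallel>1 + n D\<parallel> = \<parallel>(1 + D)\<^sup>n\<parallel> \<le> 1\<close> for all \<open>n\<close>, which forces \<open>D = 0\<close>.

  A Moore-Penrose inverse \<open>S\<close> of \<open>T\<close> yields \<open>P = ST\<close> and \<open>Q = TS\<close>. Conversely, \<open>S\<close> is \<open>Q\<close>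
  followed by the inverse of the bijection \<open>R(P) \<rightarrow> R(Q)\<close> induced by \<open>T\<close>. Its boundedness
  follows from the open mapping theorem applied to the surjection
  \<open>(x, z) \<mapsto> Tx + (z - Qz)\<close> of \<open>X \<times> X\<close> onto \<open>X\<close>.\<close>

section \<open>The open mapping theorem\<close>

text \<open>The Baire step: the closures of the images of the balls of integer radius cover the
  complete space \<open>'b\<close>, so one of them contains a ball. Moving that ball to the origin
  and rescaling gives approximate preimages with a uniform bound.\<close>

lemma surj_almost_preimage:
  fixes f :: "'a::real_normed_vector \<Rightarrow> 'b::banach"
  assumes f: "bounded_linear f" and "surj f"
  obtains M where "M \<ge> 0" "\<And>y. \<exists>x. norm x \<le> M * norm y \<and> norm (y - f x) \<le> norm y / 2"
proof -
  interpret f: bounded_linear f by (rule f)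
  define A where "A n = closure (f ` cball 0 (real n))" for n
  have "y \<in> (\<Union>n. A n)" for y
  proof -
    obtain x where "y = f x" using \<open>surj f\<close> by auto
    moreover obtain n where "norm x \<le> real n" using real_arch_simple by blast
    ultimately have "y \<in> A n"
      unfolding A_def by (intro subsetD[OF closure_subset]) auto
    then show ?thesis by blast
  qed
  then have cover: "\<Union>(range A) = UNIV" by blast
  have "\<exists>n. interior (A n) \<noteq> {}"
  proof (rule ccontr)
    assume "\<not> ?thesis"
    then have nowhere: "closedin euclidean S \<and> euclidean interior_of S = {}" if "S \<in> range A" for S
      using that by (auto simp: A_def closed_closedin[symmetric])
    have "euclidean interior_of \<Union>(range A) = {}"
    proof (rule Baire_category_alt)
      show "completely_metrizable_space (euclidean :: 'b topology) \<or>
          locally_compact_space (euclidean :: 'b topology) \<and> regular_space (euclidean :: 'b topology)"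
        using completely_metrizable_space_euclidean by blast
    qed (simp, rule nowhere)
    with cover show False by simp
  qed
  then obtain n y0 e where "e > 0" and ball: "ball y0 e \<subseteq> A n"
    by (meson ex_in_conv mem_interior)
  \<comment> \<open>Subtracting approximate preimages of \<open>y0 + y\<close> and \<open>y0\<close>
    recentres the ball at the origin; the radius doubles and the two errors of \<open>d / 2\<close>
    add up.\<close>
  have approx: "\<exists>x. norm x \<le> 2 * real n \<and> norm (y - f x) < d" if "norm y < e" "d > 0" for y d
  proof -
    have "y0 + y \<in> A n" "y0 \<in> A n"
      by (rule subsetD[OF ball], use that \<open>e > 0\<close> in \<open>simp add: dist_norm\<close>)+
    moreover have "\<exists>u. norm u \<le> real n \<and> dist (f u) z < d / 2" if "z \<in> A n" for z
      using that half_gt_zero[OF \<open>d > 0\<close>] unfolding A_def closure_approachable by fastforce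
    ultimately obtain u v where u: "norm u \<le> real n" "dist (f u) (y0 + y) < d / 2"
      and v: "norm v \<le> real n" "dist (f v) y0 < d / 2"
      by meson
    have "norm (u - v) \<le> 2 * real n"
      using u v norm_triangle_ineq4[of u v] by simp
    moreover have "norm (y - f (u - v)) < d"
    proof -
      have eq: "y - f (u - v) = (f v - y0) - (f u - (y0 + y))" by (simp add: f.diff)
      show ?thesis
        using u v norm_triangle_ineq4[of "f v - y0" "f u - (y0 + y)"]
        unfolding eq dist_norm by linarith
    qed
    ultimately show ?thesis by blast
  qed
  show thesis
  proof
    show "4 * real n / e \<ge> 0" using \<open>e > 0\<close> by simp
    fix y
    show "\<exists>x. norm x \<le> 4 * real n / e * norm y \<and> norm (y - f x) \<le> norm y / 2"
    proof (cases "y = 0")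
      case True
      then show ?thesis by (intro exI[of _ 0]) (simp add: f.zero)
    next
      case False
      \<comment> \<open>This scale gives \<open>y\<close> the norm \<open>e / 2\<close>, inside the
        ball; accuracy \<open>e / 4\<close> there becomes \<open>norm y / 2\<close> after scaling
        back.\<close>
      define c where "c = 2 * norm y / e"
      have "c > 0" using False \<open>e > 0\<close> by (simp add: c_def)
      have "norm (y /\<^sub>R c) < e"
        using False \<open>e > 0\<close> \<open>c > 0\<close> by (simp add: c_def field_simps)
      from approx[OF this, of "e / 4"] obtain x
        where x: "norm x \<le> 2 * real n" "norm (y /\<^sub>R c - f x) < e / 4"
        using \<open>e > 0\<close> by auto
      have "norm (c *\<^sub>R x) \<le> c * (2 * real n)"
        using x \<open>c > 0\<close> by simp
      moreover have "norm (y - f (c *\<^sub>R x)) \<le> c * (e / 4)"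
      proof -
        have "y - f (c *\<^sub>R x) = c *\<^sub>R (y /\<^sub>R c - f x)"
          using \<open>c > 0\<close> by (simp add: f.scaleR scaleR_diff_right)
        then have "norm (y - f (c *\<^sub>R x)) = c * norm (y /\<^sub>R c - f x)"
          using \<open>c > 0\<close> by simp
        then show ?thesis using x \<open>c > 0\<close> by simp
      qed
      ultimately show ?thesis
        using \<open>e > 0\<close> by (intro exI[of _ "c *\<^sub>R x"]) (simp add: c_def field_simps)
    qed
  qed
qed

text \<open>Successive correction: each approximate preimage halves the residual, so the corrections
  form an absolutely convergent series in the complete space \<open>'a\<close>, whose sum is an
  exact preimage.\<close>

theorem open_mapping_bound:
  fixes f :: "'a::banach \<Rightarrow> 'b::banach"
  assumes f: "bounded_linear f" and "surj f"
  obtains M where "\<And>y. \<exists>x. f x = y \<and> norm x \<le> M * norm y"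
proof -
  interpret f: bounded_linear f by (rule f)
  obtain M g where "M \<ge> 0" and g: "\<And>y. norm (g y) \<le> M * norm y"
    "\<And>y. norm (y - f (g y)) \<le> norm y / 2"
    using surj_almost_preimage[OF assms] by metis
  show thesis
  proof
    fix y
    \<comment> \<open>The residual after \<open>k\<close> corrections; \<open>f (g (r k))\<close> is
      the difference of consecutive residuals, so the image series telescopes to
      \<open>y\<close>.\<close>
    define r where "r k = ((\<lambda>z. z - f (g z)) ^^ k) y" for k
    have r_Suc: "r (Suc k) = r k - f (g (r k))" for k by (simp add: r_def)
    have r_le: "norm (r k) \<le> norm y * (1 / 2) ^ k" for k
    proof (induction k)
      case (Suc k)
      then show ?case using g(2)[of "r k"] by (simp add: r_Suc)
    qed (simp add: r_def)
    have g_le: "norm (g (r k)) \<le> M * norm y * (1 / 2) ^ k" for k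
      using g(1)[of "r k"] mult_left_mono[OF r_le[of k] \<open>M \<ge> 0\<close>] by (simp add: mult.assoc)
    have geo: "(\<lambda>k. M * norm y * (1 / 2) ^ k) sums (M * norm y * 2)"
      using sums_mult[OF geometric_sums[of "1 / 2 :: real"]] by simp
    have sm: "summable (\<lambda>k. norm (g (r k)))"
      by (rule summable_comparison_test'[OF sums_summable[OF geo], of 0]) (use g_le in simp)
    define x where "x = (\<Sum>k. g (r k))"
    have "norm x \<le> (\<Sum>k. norm (g (r k)))"
      unfolding x_def by (rule summable_norm[OF sm])
    also have "\<dots> \<le> M * norm y * 2"
      using suminf_le[OF g_le sm sums_summable[OF geo]] sums_unique[OF geo] by simp
    finally have "norm x \<le> 2 * M * norm y" by (simp add: mult.commute mult.left_commute)
    moreover have "f x = y"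
    proof (rule sums_unique2)
      show "(\<lambda>k. f (g (r k))) sums f x"
        unfolding x_def by (intro f.sums summable_sums summable_norm_cancel[OF sm])
      have "(\<lambda>k. norm y * (1 / 2) ^ k) \<longlonglongrightarrow> norm y * 0"
        by (intro tendsto_intros LIMSEQ_power_zero) simp
      then have "r \<longlonglongrightarrow> 0"
        by (intro Lim_null_comparison[of r]) (auto intro: r_le always_eventually)
      from telescope_sums'[OF this] show "(\<lambda>k. f (g (r k))) sums y"
        by (simp add: r_Suc) (simp add: r_def)
    qed
    ultimately show "\<exists>x. f x = y \<and> norm x \<le> 2 * M * norm y" by blast
  qed
qed

section \<open>Hermitian idempotents\<close>

lemma scaleC_one [simp]: "1 *\<^sub>C (x::'a::complex_normed_vector) = x"
  using scaleC_of_real[of 1 x] by simp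

lemma scaleR_scaleC: "(r *\<^sub>R c) *\<^sub>C x = r *\<^sub>R (c *\<^sub>C (x::'a::complex_normed_vector))"
  by (simp only: scaleR_conv_of_real scaleC_scaleC[symmetric] scaleC_of_real)

lemma bounded_linear_scaleC_left:
  "bounded_linear (\<lambda>c. c *\<^sub>C (x::'a::complex_normed_vector))"
  by (rule bounded_linear_intro[where K = "norm x"])
    (simp_all only: scaleC_add_left scaleR_scaleC norm_scaleC order_refl)

text \<open>All positive powers of \<open>p\<close> equal \<open>p\<close>, so the series is the
  scalar exponential series times \<open>p\<close>, except that its zeroth term is \<open>1\<close>
  instead of \<open>p\<close>; the correction is \<open>1 - p\<close>.\<close>

lemma banach_exp_idempotent:
  fixes p :: "'a::{complex_banach_algebra, monoid_mult}"
  assumes "p * p = p"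
  shows "banach_exp (c *\<^sub>C p) = 1 + (exp c - 1) *\<^sub>C p"
proof -
  have pow: "(c *\<^sub>C p) ^ Suc n = (c ^ Suc n) *\<^sub>C p" for n
    by (induction n)
      (simp_all add: assms mult_scaleC_left mult_scaleC_right scaleC_scaleC mult.commute)
  have "(c *\<^sub>C p) ^ n /\<^sub>R fact n = (c ^ n /\<^sub>R fact n) *\<^sub>C p + (if n = 0 then 1 - p else 0)" for n
  proof (cases n)
    case (Suc m)
    then show ?thesis
      by (simp only: pow scaleR_scaleC) simp
  qed simp
  moreover have "(\<lambda>n. (c ^ n /\<^sub>R fact n) *\<^sub>C p + (if n = 0 then 1 - p else 0))
      sums (exp c *\<^sub>C p + (1 - p))"
    by (intro sums_add bounded_linear.sums[OF bounded_linear_scaleC_left] exp_converges)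
      (rule sums_single)
  ultimately have "banach_exp (c *\<^sub>C p) = exp c *\<^sub>C p + (1 - p)"
    by (simp add: banach_exp_def sums_unique[symmetric])
  also have "\<dots> = 1 + (exp c - 1) *\<^sub>C p"
    using linear_diff[OF bounded_linear.linear[OF bounded_linear_scaleC_left[of p]], of "exp c" 1] by simp
  finally show ?thesis .
qed

lemma norm_hermitian_reflection:
  fixes p :: "'a::{complex_banach_algebra, monoid_mult}"
  assumes "p * p = p" "hermitian p"
  shows "norm (1 - 2 *\<^sub>R p) = 1"
proof -
  have "(- 2) *\<^sub>C p = - (2 *\<^sub>R p)"
    using scaleC_of_real[of "- 2" p] by simp
  then have "banach_exp ((\<i> * complex_of_real pi) *\<^sub>C p) = 1 - 2 *\<^sub>R p"
    using banach_exp_idempotent[OF assms(1), of "\<i> * complex_of_real pi"]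
    by (simp add: exp_pi_i')
  then show ?thesis using assms(2) unfolding hermitian_def by metis
qed

text \<open>The powers of \<open>1 + d\<close> grow linearly unless \<open>d = 0\<close>, yet
  submultiplicativity keeps their norms at most one.\<close>

lemma square_zero_eq_zero_if_norm_one_plus_le:
  fixes d :: "'a::{real_normed_algebra, monoid_mult}"
  assumes "d * d = 0" "norm (1 + d) \<le> 1"
  shows "d = 0"
proof (rule ccontr)
  have pow: "(1 + d) ^ Suc n = 1 + real (Suc n) *\<^sub>R d" for n
  proof (induction n)
    case (Suc n)
    have "(1 + d) ^ Suc (Suc n) = (1 + d) * (1 + real (Suc n) *\<^sub>R d)"
      using Suc by simp
    also have "\<dots> = 1 + (real (Suc n) *\<^sub>R d + d)"
      by (simp only: distrib_left distrib_right mult_scaleR_right assms(1)) simp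
    also have "real (Suc n) *\<^sub>R d + d = real (Suc (Suc n)) *\<^sub>R d"
      by (simp only: of_nat_Suc[of "Suc n"] scaleR_add_left) simp
    finally show ?case .
  qed simp
  \<comment> \<open>The bound starts at exponent one because this sort does not fix
    \<open>norm 1\<close>, which for the same reason enters the threshold for \<open>n\<close>
    below.\<close>
  have le: "norm ((1 + d) ^ Suc n) \<le> 1" for n
  proof (induction n)
    case (Suc n)
    have "norm ((1 + d) ^ Suc (Suc n)) \<le> norm (1 + d) * norm ((1 + d) ^ Suc n)"
      by (simp only: power_Suc[of _ "Suc n"] norm_mult_ineq)
    also have "\<dots> \<le> 1 * 1" using Suc assms(2) by (intro mult_mono) auto
    finally show ?case by simp
  qed (use assms in simp)
  assume "d \<noteq> 0"
  then obtain n where "1 + norm (1::'a) < real n * norm d"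
    using reals_Archimedean3 by (metis zero_less_norm_iff)
  also have "\<dots> \<le> real (Suc n) * norm d" by (simp add: mult_right_mono)
  also have "\<dots> = norm ((1 + d) ^ Suc n - 1)" by (simp only: pow) simp
  also have "\<dots> \<le> 1 + norm (1::'a)"
    using norm_triangle_ineq4[of "(1 + d) ^ Suc n" 1] le[of n] by linarith
  finally show False by simp
qed

text \<open>The two alternatives in \<open>pq\<close> are the algebraic forms of equal ranges and of
  equal null spaces for idempotent operators.\<close>

lemma hermitian_idempotent_unique:
  fixes p q :: "'a::{complex_banach_algebra, monoid_mult}"
  assumes p: "p * p = p" "hermitian p" and q: "q * q = q" "hermitian q"
    and pq: "p * q = q \<and> q * p = p \<or> p * q = p \<and> q * p = q"
  shows "p = q"
proof -
  define d where "d = (1 - 2 *\<^sub>R p) * (1 - 2 *\<^sub>R q) - 1"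
  have d: "d = 4 *\<^sub>R (p * q) - 2 *\<^sub>R p - 2 *\<^sub>R q"
    by (simp add: d_def algebra_simps)
  have "norm (1 + d) \<le> 1"
    using norm_mult_ineq[of "1 - 2 *\<^sub>R p" "1 - 2 *\<^sub>R q"]
      norm_hermitian_reflection[OF p] norm_hermitian_reflection[OF q] by (simp add: d_def)
  moreover have sq: "(p - q) * (p - q) = 0" "(q - p) * (q - p) = 0"
    using pq p q by (auto simp: algebra_simps)
  have four: "4 *\<^sub>R x = 2 *\<^sub>R x + 2 *\<^sub>R x" for x :: 'a
    by (simp flip: scaleR_add_left)
  have "d = 2 *\<^sub>R (p - q) \<or> d = 2 *\<^sub>R (q - p)"
    using pq four unfolding d by (auto simp: scaleR_diff_right)
  moreover from this have "d * d = 0"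
    using sq by (elim disjE) simp_all
  ultimately show "p = q"
    using square_zero_eq_zero_if_norm_one_plus_le[of d] by auto
qed

section \<open>Projections and Moore-Penrose inverses of operators\<close>

lemma apply_op_diff: "apply_op T (x - y) = apply_op T x - apply_op T y"
  using apply_op_linear(1)[of T "x - y" y] by simp

lemma bounded_linear_apply_op: "bounded_linear (apply_op T)"
  by transfer (rule blinfun.bounded_linear_right)

lemma idempotent_fixes_range:
  assumes "P * P = P" "x \<in> range_space P"
  shows "apply_op P x = x"
proof -
  obtain y where "x = apply_op P y" using assms(2) unfolding range_space_def by blast
  then show ?thesis using apply_op_simps(7)[of P P y] assms(1) by simp
qed

lemma idempotent_mult_eq_if_range_subset:
  assumes "P * P = P" "range_space S \<subseteq> range_space P"
  shows "P * S = S"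
proof (rule bdd_op_eqI)
  fix x
  have "apply_op S x \<in> range_space P"
    using assms(2) by (auto simp: range_space_def)
  then show "apply_op (P * S) x = apply_op S x"
    by (simp add: idempotent_fixes_range[OF assms(1)])
qed

text \<open>The vector \<open>P x - x\<close> lies in the null space of \<open>P\<close>, hence
  \<open>S\<close> annihilates it.\<close>

lemma mult_idempotent_eq_if_null_space_subset:
  assumes "P * P = P" "null_space P \<subseteq> null_space S"
  shows "S * P = S"
proof (rule bdd_op_eqI)
  fix x
  have "apply_op P (apply_op P x - x) = 0"
    using apply_op_simps(7)[of P P x] assms(1) by (simp add: apply_op_diff)
  then have "apply_op S (apply_op P x - x) = 0"
    using assms(2) by (auto simp: null_space_def)
  then show "apply_op (S * P) x = apply_op S x" by (simp add: apply_op_diff)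
qed

lemma hermitian_idempotents_eq_if_range_eq:
  assumes "P \<in> \<E>" "Q \<in> \<E>" "range_space P = range_space Q"
  shows "P = Q"
proof -
  have P: "P * P = P" "hermitian P" and Q: "Q * Q = Q" "hermitian Q"
    using assms(1,2) by (simp_all add: hermitian_idempotents_def)
  have "P * Q = Q" "Q * P = P"
    by (rule idempotent_mult_eq_if_range_subset[OF P(1)]
        idempotent_mult_eq_if_range_subset[OF Q(1)]; simp add: assms(3))+
  then show ?thesis
    using hermitian_idempotent_unique[OF P Q] by blast
qed

lemma hermitian_idempotents_eq_if_null_space_eq:
  assumes "P \<in> \<E>" "Q \<in> \<E>" "null_space P = null_space Q"
  shows "P = Q"
proof -
  have P: "P * P = P" "hermitian P" and Q: "Q * Q = Q" "hermitian Q"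
    using assms(1,2) by (simp_all add: hermitian_idempotents_def)
  have "Q * P = Q" "P * Q = P"
    by (rule mult_idempotent_eq_if_null_space_subset[OF P(1)]
        mult_idempotent_eq_if_null_space_subset[OF Q(1)]; simp add: assms(3))+
  then show ?thesis
    using hermitian_idempotent_unique[OF P Q] by blast
qed

text \<open>Arbitrary sets \<open>N\<close> and \<open>R\<close> let one statement serve all three
  uniqueness claims.\<close>

lemma hermitian_idempotents_unique:
  "\<forall>P\<in>\<E>. \<forall>Q\<in>\<E>. \<forall>P'\<in>\<E>. \<forall>Q'\<in>\<E>.
     null_space P = N \<and> range_space Q = R \<and> null_space P' = N \<and> range_space Q' = R
     \<longrightarrow> P = P' \<and> Q = Q'"
  by (intro ballI impI conjI)
    (rule hermitian_idempotents_eq_if_null_space_eq hermitian_idempotents_eq_if_range_eq; simp; fail)+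

lemma projections_if_generalized_inverse:
  assumes "T = T * S * T"
  shows "null_space (S * T) = null_space T" "range_space (T * S) = range_space T"
proof -
  have T: "apply_op T x = apply_op T (apply_op S (apply_op T x))" for x
    using arg_cong[OF assms, of "\<lambda>U. apply_op U x"] by simp
  have zero: "apply_op U 0 = 0" for U :: "'a bdd_op"
    using apply_op_diff[of U 0 0] by simp
  show "null_space (S * T) = null_space T"
    unfolding null_space_def by (auto simp: zero) (metis T zero)
  show "range_space (T * S) = range_space T"
    unfolding range_space_def by (auto simp: image_iff) (metis T)
qed

text \<open>The operator \<open>S\<close> sends \<open>y\<close> to \<open>P x\<close> for any
  \<open>x\<close> with \<open>T x = Q y\<close>; the choice of \<open>x\<close> is immaterial
  because \<open>P\<close> and \<open>T\<close> have the same null space.\<close>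

lemma generalized_inverse_if_projections:
  fixes T :: "'a::complex_banach bdd_op"
  assumes P: "P * P = P" "null_space P = null_space T"
    and Q: "Q * Q = Q" "range_space Q = range_space T"
  obtains S where "S * T = P" "T * S = Q" "S * Q = S"
proof -
  have QT: "apply_op Q (apply_op T x) = apply_op T x" for x
    using Q by (intro idempotent_fixes_range) (auto simp: range_space_def)
  \<comment> \<open>The second summand supplies the complement of the range of \<open>T\<close>, so
    the open mapping bound applies on the whole space rather than on a subspace.\<close>
  define f where "f = (\<lambda>(x, z). apply_op T x + (z - apply_op Q z))"
  have "bounded_linear f"
    unfolding f_def case_prod_beta
    by (intro bounded_linear_add bounded_linear_sub bounded_linear_fst bounded_linear_snd
        bounded_linear_compose[OF bounded_linear_apply_op])
  moreover have "surj f"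
    unfolding surj_def
  proof
    fix y
    obtain x where "apply_op Q y = apply_op T x"
      using Q(2) unfolding range_space_def by blast
    then show "\<exists>u. y = f u" by (intro exI[of _ "(x, y)"]) (simp add: f_def)
  qed
  ultimately obtain M where M: "\<And>y. \<exists>u. f u = y \<and> norm u \<le> M * norm y"
    using open_mapping_bound[of f] by blast
  \<comment> \<open>Applying \<open>Q\<close> to \<open>f (x, z) = y\<close> removes the part coming
    from \<open>z\<close> and leaves a norm-controlled solution of \<open>T x = Q y\<close>.\<close>
  have "\<exists>x. apply_op T x = apply_op Q y \<and> norm x \<le> M * norm y" for y
  proof -
    obtain x z where xz: "f (x, z) = y" "norm (x, z) \<le> M * norm y"
      using M[of y] by auto
    have "apply_op Q z = apply_op Q (apply_op Q z)"
      using Q(1) apply_op_simps(7)[of Q Q z] by simp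
    then have "apply_op Q y = apply_op T x"
      using xz(1) by (auto simp: f_def apply_op_linear(1) apply_op_diff QT)
    moreover have "norm x \<le> M * norm y"
      using xz(2) norm_fst_le[of x z] by simp
    ultimately show ?thesis by metis
  qed
  then obtain g where g: "\<And>y. apply_op T (g y) = apply_op Q y" "\<And>y. norm (g y) \<le> M * norm y"
    by metis
  have P_eq: "apply_op P x = apply_op P y" if "apply_op T x = apply_op T y" for x y
    using that P(2) by (auto simp: null_space_def set_eq_iff apply_op_diff dest: spec[of _ "x - y"])
  define s where "s y = apply_op P (g y)" for y
  \<comment> \<open>The pointwise choice \<open>g\<close> need not be linear. Linearity of
    \<open>s\<close> and the identities for \<open>S\<close> all come from this freedom to replace
    \<open>g y\<close> by another solution.\<close>
  have s_eq: "s y = apply_op P x" if "apply_op T x = apply_op Q y" for x y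
    unfolding s_def using that g by (intro P_eq) simp
  have s_C: "s (c *\<^sub>C y) = c *\<^sub>C s y" for c y
    unfolding s_def[of y] apply_op_linear(2)[symmetric]
    by (rule s_eq) (simp add: apply_op_linear g)
  interpret P: bounded_linear "apply_op P" by (rule bounded_linear_apply_op)
  obtain K where "K \<ge> 0" and K: "\<And>x. norm (apply_op P x) \<le> norm x * K"
    using P.nonneg_bounded by blast
  have s_lin: "bounded_linear s"
  proof (rule bounded_linear_intro[where K = "M * K"])
    show "s (x + y) = s x + s y" for x y
      unfolding s_def[of x] s_def[of y] apply_op_linear(1)[symmetric]
      by (rule s_eq) (simp add: apply_op_linear g)
    show "s (r *\<^sub>R y) = r *\<^sub>R s y" for r y
      using s_C[of "complex_of_real r" y] by (simp add: scaleC_of_real)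
    show "norm (s y) \<le> norm y * (M * K)" for y
      using K[of "g y"] mult_right_mono[OF g(2)[of y] \<open>K \<ge> 0\<close>]
      by (simp add: s_def mult.commute mult.left_commute)
  qed
  define S where "S = Bdd_op (Blinfun s)"
  have S: "apply_op S y = s y" for y
    by (simp add: S_def apply_op.rep_eq Bdd_op_inverse s_C bounded_linear_Blinfun_apply[OF s_lin])
  have "T * P = T"
    by (rule mult_idempotent_eq_if_null_space_subset[OF P(1)]) (simp add: P(2))
  then have TP: "apply_op T (apply_op P x) = apply_op T x" for x
    by (metis apply_op_simps(7))
  show thesis
  proof
    show "S * T = P" by (rule bdd_op_eqI) (simp add: S s_eq[OF QT[symmetric]])
    show "T * S = Q"
    proof (rule bdd_op_eqI)
      show "apply_op (T * S) y = apply_op Q y" for y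
        by (simp add: S s_def TP g)
    qed
    show "S * Q = S"
    proof (rule bdd_op_eqI)
      fix y
      have "apply_op Q (apply_op Q y) = apply_op Q y"
        using apply_op_simps(7)[of Q Q y] Q(1) by simp
      then have "s (apply_op Q y) = s y"
        unfolding s_def[of y] by (intro s_eq) (simp add: g)
      then show "apply_op (S * Q) y = apply_op S y" by (simp add: S)
    qed
  qed
qed

text \<open>In the converse direction \<open>S * T\<close> and \<open>T * S\<close> are exactly
  \<open>P\<close> and \<open>Q\<close>, so they inherit hermiticity and only the two algebraic
  identities remain.\<close>

lemma has_moore_penrose_inverse_iff:
  fixes T :: "'a::complex_banach bdd_op"
  shows "has_moore_penrose_inverse T \<longleftrightarrow>
    (\<exists>P\<in>\<E>. \<exists>Q\<in>\<E>. null_space P = null_space T \<and> range_space Q = range_space T)"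
    (is "_ \<longleftrightarrow> ?R")
proof
  assume "has_moore_penrose_inverse T"
  then obtain S where S: "T = T * S * T" "S = S * T * S" "hermitian (T * S)" "hermitian (S * T)"
    unfolding has_moore_penrose_inverse_def moore_penrose_inverse_def by blast
  have "S * T * (S * T) = S * T" "T * S * (T * S) = T * S"
    using arg_cong[OF S(2)[symmetric], of "\<lambda>U. U * T"] arg_cong[OF S(1)[symmetric], of "\<lambda>U. U * S"]
    by (simp_all only: mult.assoc)
  then have "S * T \<in> \<E>" "T * S \<in> \<E>"
    using S(3,4) unfolding hermitian_idempotents_def by simp_all
  then show ?R using projections_if_generalized_inverse[OF S(1)] by blast
next
  assume ?R
  then obtain P Q where PQ: "P * P = P" "hermitian P" "Q * Q = Q" "hermitian Q"
    "null_space P = null_space T" "range_space Q = range_space T"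
    unfolding hermitian_idempotents_def by blast
  then obtain S where S: "S * T = P" "T * S = Q" "S * Q = S"
    using generalized_inverse_if_projections by blast
  have "T * S * T = T"
    unfolding S(2) by (rule idempotent_mult_eq_if_range_subset[OF PQ(3)]) (simp add: PQ(6))
  moreover have "S * T * S = S"
    by (simp only: mult.assoc S(2,3))
  ultimately have "moore_penrose_inverse T S"
    unfolding moore_penrose_inverse_def using S(1,2) PQ(2,4) by metis
  then show "has_moore_penrose_inverse T"
    unfolding has_moore_penrose_inverse_def by blast
qed

section \<open>Left and right multiplication operators\<close>

lemma null_space_mult_op:
  "null_space (left_mult_op a) = {x. a * x = 0}"
  "null_space (right_mult_op a) = {x. x * a = 0}"
  by (simp_all add: null_space_def)

lemma range_space_mult_op:
  "range_space (left_mult_op a) = range (\<lambda>x. a * x)"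
  "range_space (right_mult_op a) = range (\<lambda>x. x * a)"
  by (simp_all add: range_space_def)

theorem theorem6:
  fixes T :: "'x::complex_banach bdd_op"
    and a :: "'a::complex_unital_banach_algebra"
  shows
    "(has_moore_penrose_inverse T \<longleftrightarrow>
        (\<exists>P\<in>\<E>. \<exists>Q\<in>\<E>. null_space P = null_space T \<and> range_space Q = range_space T))
     \<and> (\<forall>P\<in>\<E>. \<forall>Q\<in>\<E>. \<forall>P'\<in>\<E>. \<forall>Q'\<in>\<E>.
          null_space P = null_space T \<and> range_space Q = range_space T \<and>
          null_space P' = null_space T \<and> range_space Q' = range_space T
          \<longrightarrow> P = P' \<and> Q = Q')

     \<and> (has_moore_penrose_inverse (left_mult_op a) \<longleftrightarrow>
        (\<exists>P\<in>\<E>. \<exists>Q\<in>\<E>. null_space P = {x. a * x = 0} \<and> range_space Q = range (\<lambda>x. a * x)))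
     \<and> (\<forall>P\<in>\<E>. \<forall>Q\<in>\<E>. \<forall>P'\<in>\<E>. \<forall>Q'\<in>\<E>.
          null_space P = {x. a * x = 0} \<and> range_space Q = range (\<lambda>x. a * x) \<and>
          null_space P' = {x. a * x = 0} \<and> range_space Q' = range (\<lambda>x. a * x)
          \<longrightarrow> P = P' \<and> Q = Q')

     \<and> (has_moore_penrose_inverse (right_mult_op a) \<longleftrightarrow>
        (\<exists>P\<in>\<E>. \<exists>Q\<in>\<E>. null_space P = {x. x * a = 0} \<and> range_space Q = range (\<lambda>x. x * a)))
     \<and> (\<forall>P\<in>\<E>. \<forall>Q\<in>\<E>. \<forall>P'\<in>\<E>. \<forall>Q'\<in>\<E>.
          null_space P = {x. x * a = 0} \<and> range_space Q = range (\<lambda>x. x * a) \<and>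
          null_space P' = {x. x * a = 0} \<and> range_space Q' = range (\<lambda>x. x * a)
          \<longrightarrow> P = P' \<and> Q = Q')"
  by (intro conjI hermitian_idempotents_unique has_moore_penrose_inverse_iff
      has_moore_penrose_inverse_iff[of "left_mult_op a", unfolded null_space_mult_op range_space_mult_op]
      has_moore_penrose_inverse_iff[of "right_mult_op a", unfolded null_space_mult_op range_space_mult_op])

end
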